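(* Let $r\ge 1$ and $k\ge 1$ be integers, and let $T$ satisfy $T(n)=\sum_{p=1}^{k} T(S_p(n))$ for $n>r$ with $r$ given initial values, where each spot function $S_p(n)$ depends only on $n$ and the values $T(j)$, $j<n$, and satisfies $1\le S_p(n)<n$ for $n>r$. Fix $p$ and define $M_p(n)=1$ for $1\le n\le r$, $M_p(n)=M_p(S_p(n))+1$ for $n>r$. For $g\ge1$ let $G_p(g)=M_p^{-1}(\{g\})$, $\alpha_p(g)=\min G_p(g)$ and $\beta_p(g)=\max G_p(g)$ (when these exist). If $(S_p(n))_{n>r}$ is slow-growing, then the generation structure with respect to $M_p$ is an interval structure: every nonempty generation $G_p(g)$ is a set of consecutive positive integers (equal to $[\alpha_p(g),\beta_p(g)]$ when it is finite, and to $[\alpha_p(g),\infty)$ otherwise). Further, for $g\ge1$, whenever $G_p(g+1)$ is nonempty, $G_p(g)$ is finite and $\beta_p(g)=\alpha_p(g+1)-1$.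
   Context: A sequence is slow-growing if it is nondecreasing with successive differences in $\{0,1\}$. $G_p(g)$ is the $g$-th generation with respect to the $p$-th spot function; $\alpha_p(g)$ and $\beta_p(g)$ are its beginning and end. *)

theory Defs
  imports Main
begin

text \<open>Sequences are functions on \<^typ>\<open>nat\<close> whose relevant indices start at 1; the value at 0 is
  irrelevant. A spot function is a functional \<open>\<sigma> p n F\<close> of the index \<open>n\<close> and the sequence \<open>F\<close> that may
  look only at \<open>F 1, \<dots>, F (n - 1)\<close>; the paper's \<open>S\<^sub>p(n)\<close> is \<open>\<sigma> p n T\<close>.\<close>

definition depends_only_on_past ::
  "nat \<Rightarrow> (nat \<Rightarrow> (nat \<Rightarrow> 'a) \<Rightarrow> nat) \<Rightarrow> bool" where
  "depends_only_on_past r s \<longleftrightarrow>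
     (\<forall>n>r. \<forall>F F'. (\<forall>j\<in>{1..<n}. F j = F' j) \<longrightarrow> s n F = s n F')"

definition nested_recurrence ::
  "nat \<Rightarrow> nat \<Rightarrow> (nat \<Rightarrow> nat \<Rightarrow> (nat \<Rightarrow> 'a) \<Rightarrow> nat) \<Rightarrow> (nat \<Rightarrow> 'a::comm_monoid_add)
     \<Rightarrow> (nat \<Rightarrow> 'a) \<Rightarrow> bool" where
  "nested_recurrence r k \<sigma> init T \<longleftrightarrow>
     (\<forall>p\<in>{1..k}. depends_only_on_past r (\<sigma> p)) \<and>
     (\<forall>p\<in>{1..k}. \<forall>n>r. 1 \<le> \<sigma> p n T \<and> \<sigma> p n T < n) \<and>
     (\<forall>n\<in>{1..r}. T n = init n) \<and>
     (\<forall>n>r. T n = (\<Sum>p=1..k. T (\<sigma> p n T)))"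

definition slow_growing_beyond :: "nat \<Rightarrow> (nat \<Rightarrow> nat) \<Rightarrow> bool" where
  "slow_growing_beyond r s \<longleftrightarrow>
     mono_on {r<..} s \<and> (\<forall>n>r. int (s (n + 1)) - int (s n) \<in> {0, 1})"

text \<open>The test \<open>S n < n\<close> only serves termination; it always holds for \<open>n > r\<close> when \<open>S\<close> comes from a
  nested recurrence, see \<open>generation_map_rec\<close>.\<close>

function generation_map :: "nat \<Rightarrow> (nat \<Rightarrow> nat) \<Rightarrow> nat \<Rightarrow> nat" where
  "generation_map r S n = (if n > r \<and> S n < n then generation_map r S (S n) + 1 else 1)"
  by pat_completeness auto
termination by (relation "Wellfounded.measure (\<lambda>(r, S, n). n)") auto

declare generation_map.simps [simp del]

lemma generation_map_init: "n \<le> r \<Longrightarrow> generation_map r S n = 1"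
  by (simp add: generation_map.simps)

lemma generation_map_rec:
  "n > r \<Longrightarrow> S n < n \<Longrightarrow> generation_map r S n = generation_map r S (S n) + 1"
  by (subst generation_map.simps) simp

definition generation :: "nat \<Rightarrow> (nat \<Rightarrow> nat) \<Rightarrow> nat \<Rightarrow> nat set" where
  "generation r S g = {n. n \<ge> 1 \<and> generation_map r S n = g}"

text \<open>The beginning is meaningful only for nonempty generations, the end only for finite nonempty
  ones.\<close>

definition gen_begin :: "nat \<Rightarrow> (nat \<Rightarrow> nat) \<Rightarrow> nat \<Rightarrow> nat" where
  "gen_begin r S g = (LEAST n. n \<in> generation r S g)"

definition gen_end :: "nat \<Rightarrow> (nat \<Rightarrow> nat) \<Rightarrow> nat \<Rightarrow> nat" where
  "gen_end r S g = Max (generation r S g)"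

definition consecutive_positive :: "nat set \<Rightarrow> bool" where
  "consecutive_positive A \<longleftrightarrow> A \<subseteq> {1..} \<and> (\<forall>a\<in>A. \<forall>b\<in>A. {a..b} \<subseteq> A)"

definition interval_structure :: "nat \<Rightarrow> (nat \<Rightarrow> nat) \<Rightarrow> bool" where
  "interval_structure r S \<longleftrightarrow>
     (\<forall>g\<ge>1. generation r S g \<noteq> {} \<longrightarrow> consecutive_positive (generation r S g))"

end

theory Submission
  imports Defs
begin

text \<open>By strong induction, the generation map inherits unit steps from the spot function: for
  \<open>n > r\<close> its values at \<open>n\<close> and \<open>n + 1\<close> are one more than its values at \<open>S n\<close> and
  \<open>S (n + 1) \<in> {S n, S n + 1}\<close>. Hence it is nondecreasing, its fibres are intervals, and the
  predecessor of the first element of a generation lies in the previous generation.\<close>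

lemma generation_map_step:
  assumes "\<And>n. n > r \<Longrightarrow> 1 \<le> S n \<and> S n < n"
    and "\<And>n. n > r \<Longrightarrow> S (Suc n) = S n \<or> S (Suc n) = Suc (S n)"
  shows "generation_map r S (Suc n) = generation_map r S n
    \<or> generation_map r S (Suc n) = Suc (generation_map r S n)"
proof (induction n rule: less_induct)
  case (less n)
  consider "n < r" | "n = r" | "n > r" by linarith
  then show ?case
  proof cases
    case 1
    then show ?thesis by (simp add: generation_map_init)
  next
    case 2
    have "S (Suc r) \<le> r" using assms(1)[of "Suc r"] by simp
    then show ?thesis using 2
      by (simp add: generation_map_init generation_map_rec)
  next
    case 3
    then have "S n < n" and "S (Suc n) < Suc n" using assms(1) by auto
    then show ?thesis
      \<comment> \<open>If \<open>S\<close> stays put, the two values agree. If it moves on by one,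
        the step at \<open>n\<close> equals the step at the earlier index
        \<open>S n\<close>.\<close>
      using 3 less.IH[of "S n"] assms(2)[OF 3] by (auto simp: generation_map_rec)
  qed
qed

lemma mono_generation_map:
  assumes "\<And>n. generation_map r S (Suc n) = generation_map r S n
    \<or> generation_map r S (Suc n) = Suc (generation_map r S n)"
  shows "mono (generation_map r S)"
  unfolding mono_iff_le_Suc using assms by (metis le_Suc_eq order_refl)

text \<open>Monotonicity squeezes the value at any \<open>n\<close> between \<open>a\<close> and
  \<open>b\<close> to the common value \<open>g\<close>, and \<open>n\<close> is positive because
  \<open>a\<close> is.\<close>

lemma consecutive_positive_generation:
  assumes "mono (generation_map r S)"
  shows "consecutive_positive (generation r S g)"
  unfolding consecutive_positive_def
proof (intro conjI ballI subsetI)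
  fix n a b
  assume "a \<in> generation r S g" "b \<in> generation r S g" "n \<in> {a..b}"
  then show "n \<in> generation r S g"
    using monoD[OF assms, of a n] monoD[OF assms, of n b] by (simp add: generation_def)
qed (simp add: generation_def)

lemma gen_begin_in: "generation r S g \<noteq> {} \<Longrightarrow> gen_begin r S g \<in> generation r S g"
  unfolding gen_begin_def by (metis LeastI ex_in_conv)

lemma gen_begin_le: "n \<in> generation r S g \<Longrightarrow> gen_begin r S g \<le> n"
  unfolding gen_begin_def by (rule Least_le)

lemma finite_generation_eq:
  assumes "consecutive_positive (generation r S g)" "generation r S g \<noteq> {}"
    and "finite (generation r S g)"
  shows "generation r S g = {gen_begin r S g..gen_end r S g}"
proof
  show "generation r S g \<subseteq> {gen_begin r S g..gen_end r S g}"
    using assms(3) by (auto simp: gen_end_def intro: gen_begin_le)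
  show "{gen_begin r S g..gen_end r S g} \<subseteq> generation r S g"
    using assms(1) gen_begin_in[OF assms(2)] Max_in[OF assms(3,2)]
    unfolding consecutive_positive_def gen_end_def by blast
qed

text \<open>An infinite set of naturals is unbounded, so each \<open>n\<close> from the beginning on
  lies between the beginning and some later member \<open>m\<close>, and the gap between these two
  is filled.\<close>

lemma infinite_generation_eq:
  assumes "consecutive_positive (generation r S g)" and "infinite (generation r S g)"
  shows "generation r S g = {gen_begin r S g..}"
proof
  show "generation r S g \<subseteq> {gen_begin r S g..}" by (auto intro: gen_begin_le)
  have begin_in: "gen_begin r S g \<in> generation r S g"
    using assms(2) by (intro gen_begin_in) auto
  show "{gen_begin r S g..} \<subseteq> generation r S g"
  proof
    fix n assume "n \<in> {gen_begin r S g..}"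
    then have "gen_begin r S g \<le> n" by simp
    moreover obtain m where "m \<ge> n" "m \<in> generation r S g"
      using assms(2) unfolding finite_nat_set_iff_bounded_le by (meson nat_le_linear)
    moreover have "{gen_begin r S g..m} \<subseteq> generation r S g"
      using begin_in \<open>m \<in> generation r S g\<close> assms(1)
      unfolding consecutive_positive_def by blast
    ultimately show "n \<in> generation r S g" by auto
  qed
qed

text \<open>Let \<open>a\<close> be the first index of generation \<open>g + 1\<close>. By the unit
  step its predecessor \<open>b\<close> has value \<open>g\<close> or \<open>g + 1\<close>, and the
  minimality of \<open>a\<close> excludes \<open>g + 1\<close>. As the map is monotone, no index
  from \<open>a\<close> on has value \<open>g\<close>, so \<open>b\<close> is the end of generation
  \<open>g\<close>.\<close>

lemma previous_generation:
  assumes "r \<ge> 1" and "g \<ge> 1"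
    and step: "\<And>n. generation_map r S (Suc n) = generation_map r S n
      \<or> generation_map r S (Suc n) = Suc (generation_map r S n)"
    and nonempty: "generation r S (g + 1) \<noteq> {}"
  shows "generation r S g \<noteq> {} \<and> finite (generation r S g)
    \<and> gen_end r S g = gen_begin r S (g + 1) - 1"
proof -
  define a where "a = gen_begin r S (g + 1)"
  have a: "a \<ge> 1" "generation_map r S a = g + 1"
    using gen_begin_in[OF nonempty] by (auto simp: a_def generation_def)
  \<comment> \<open>Index 1 is initial because \<open>r \<ge> 1\<close>, so its value is 1, below
    \<open>g + 1\<close>. Hence the predecessor of \<open>a\<close> is still a positive index, as
    membership in a generation demands.\<close>
  have "a \<noteq> 1" using a(2) assms(1,2) by (auto simp: generation_map_init)
  then obtain b where b: "a = Suc b" "b \<ge> 1"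
    using a(1) by (cases a) auto
  have "b \<notin> generation r S (g + 1)"
    using gen_begin_le[of b r S "g + 1"] b(1) by (auto simp: a_def)
  then have "generation_map r S b = g"
    using step[of b] a(2) b by (auto simp: generation_def)
  then have b_in: "b \<in> generation r S g" using b(2) by (simp add: generation_def)
  have le_b: "n \<le> b" if "n \<in> generation r S g" for n
  proof (rule ccontr)
    assume "\<not> n \<le> b"
    then have "generation_map r S a \<le> generation_map r S n"
      using monoD[OF mono_generation_map[OF step]] b(1) by simp
    then show False using that a(2) by (simp add: generation_def)
  qed
  have fin: "finite (generation r S g)"
    using le_b by (auto simp: finite_nat_set_iff_bounded_le)
  have "gen_end r S g = b"
    unfolding gen_end_def using fin le_b b_in by (intro Max_eqI) auto
  then show ?thesis using b_in fin b(1) unfolding a_def[symmetric] by auto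
qed

theorem corollary1:
  fixes r k p :: nat
    and \<sigma> :: "nat \<Rightarrow> nat \<Rightarrow> (nat \<Rightarrow> 'a::comm_monoid_add) \<Rightarrow> nat"
    and init T :: "nat \<Rightarrow> 'a"
    and S :: "nat \<Rightarrow> nat \<Rightarrow> nat"
  defines "S \<equiv> \<lambda>q n. \<sigma> q n T"
  assumes "r \<ge> 1" and "k \<ge> 1"
    and "nested_recurrence r k \<sigma> init T"
    and "p \<in> {1..k}"
    and "slow_growing_beyond r (S p)"
  shows "interval_structure r (S p)
    \<and> (\<forall>g\<ge>1. generation r (S p) g \<noteq> {} \<longrightarrow>
          (finite (generation r (S p) g) \<longrightarrow>
             generation r (S p) g = {gen_begin r (S p) g..gen_end r (S p) g}) \<and>
          (infinite (generation r (S p) g) \<longrightarrow>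
             generation r (S p) g = {gen_begin r (S p) g..}))
    \<and> (\<forall>g\<ge>1. generation r (S p) (g + 1) \<noteq> {} \<longrightarrow>
          generation r (S p) g \<noteq> {} \<and> finite (generation r (S p) g) \<and>
          gen_end r (S p) g = gen_begin r (S p) (g + 1) - 1)"
proof -
  have bounds: "1 \<le> S p n \<and> S p n < n" if "n > r" for n
    using assms(4,5) that by (auto simp: nested_recurrence_def S_def)
  have S_step: "S p (Suc n) = S p n \<or> S p (Suc n) = Suc (S p n)" if "n > r" for n
  proof -
    have "int (S p (n + 1)) - int (S p n) \<in> {0, 1}"
      using assms(6) that by (simp add: slow_growing_beyond_def)
    \<comment> \<open>The difference is taken in \<open>int\<close>, where nothing is truncated, so
      0 means equality and 1 means successor.\<close>
    then show ?thesis by auto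
  qed
  \<comment> \<open>The facts on \<open>S p\<close> hold only beyond \<open>r\<close>, whereas this
    one covers every \<open>n\<close>, since the map is constantly 1 up to \<open>r\<close>.\<close>
  have step: "generation_map r (S p) (Suc n) = generation_map r (S p) n
    \<or> generation_map r (S p) (Suc n) = Suc (generation_map r (S p) n)" for n
    using bounds S_step by (rule generation_map_step)
  have consecutive: "consecutive_positive (generation r (S p) g)" for g
    by (intro consecutive_positive_generation mono_generation_map step)
  show ?thesis
  proof (intro conjI[of "interval_structure r (S p)"] conjI[of "All _"] allI impI)
    show "interval_structure r (S p)"
      using consecutive by (simp add: interval_structure_def)
  next
    fix g
    assume "generation r (S p) g \<noteq> {}"
    then show "(finite (generation r (S p) g) \<longrightarrow>
           generation r (S p) g = {gen_begin r (S p) g..gen_end r (S p) g}) \<and>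
        (infinite (generation r (S p) g) \<longrightarrow>
           generation r (S p) g = {gen_begin r (S p) g..})"
      by (intro conjI impI finite_generation_eq infinite_generation_eq consecutive)
  next
    fix g :: nat
    assume "g \<ge> 1" "generation r (S p) (g + 1) \<noteq> {}"
    then show "generation r (S p) g \<noteq> {} \<and> finite (generation r (S p) g) \<and>
        gen_end r (S p) g = gen_begin r (S p) (g + 1) - 1"
      using step by (intro previous_generation assms(2))
  qed
qed

end
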